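(* Let $\varepsilon\le \tfrac13$, $\kappa>0$ and $\delta\in(0,1)$. Consider a distributionally robust 2-stage problem $\min_{x\in X} h_{p^*}(x)$ (as defined in the context) satisfying properties (P1)–(P6), and let $\mathrm{OPT}=\min_{x\in X}h_{p^*}(x)$. There is a sample size $N$, bounded by a polynomial in $\lambda/\varepsilon$, $\log|X|$, $\log(\tau/\kappa)$ and $\log(1/\delta)$, such that the following holds. Let $k=\frac{2}{\varepsilon}\log(\frac1\delta)$ and, for $i=1,\dots,k$, let $\hat p^i$ be the empirical distribution of $N$ independent samples from $p^*$ (all samples independent). Suppose that for every $i$ we have a solution $\hat x^i\in X$ and a number $f^i$ such that (S1) $h_{\hat p^i}(\hat x^i)\le \beta f^i$ and (S2) $f^i\le \rho\cdot\min_{x\in X}h_{\hat p^i}(x)$, where $\beta,\rho\ge 1$. Let $j=\arg\min_{i=1,\dots,k}f^i$ and $\hat x=\hat x^j$. Then, with probability at least $1-3\delta$, $$h_{p^*}(\hat x)\le 4\beta\rho\,(1+O(\varepsilon))\,\mathrm{OPT}+2\beta\rho\kappa .$$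
   Context: Setting (distributionally robust 2-stage problem under a Wasserstein ball). $\mathcal{A}$ is a finite set of scenarios, $\mathcal{P}\subseteq\mathbb{R}^m_{\ge0}$ is a polytope of fractional first-stage decisions and $X=\mathcal{P}\cap\mathbb{Z}^m$ is the finite set of (discrete) first-stage decisions; $c\in\mathbb{R}^m$ is the first-stage cost vector. For $x\in\mathcal{P}$, $A\in\mathcal{A}$, $g(x,A)\ge 0$ denotes the optimal second-stage (recourse) cost of scenario $A$ given first-stage decision $x$ (with fractional second-stage actions). $\kappa_{sc}:\mathcal{A}\times\mathcal{A}\to\mathbb{R}_{\ge0}$ is a scenario metric (in particular $\kappa_{sc}(A,A)=0$), and $r>0$ is a radius. For a probability distribution $p$ on $\mathcal{A}$ and $x\in\mathcal{P}$ let $$z_p(x)=\max\Big\{\sum_{A,A'\in\mathcal{A}}\gamma_{A,A'}g(x,A') : \gamma\ge 0,\ \sum_{A'}\gamma_{A,A'}\le p_A\ \forall A,\ \sum_{A,A'}\kappa_{sc}(A,A')\gamma_{A,A'}\le r\Big\}$$ (this is the maximum of $\mathbb{E}_{A\sim q}[g(x,A)]$ over distributions $q$ within Wasserstein distance $r$ of $p$ w.r.t. $\kappa_{sc}$), and $h_p(x)=c^\top x+z_p(x)$. The central distribution $p^*$ is arbitrary and accessible only by drawing independent samples. $\mathcal{I}$ denotes the input size. Properties: (P1) $0\in X$, $c\ge0$, $\log|X|$ is polynomial in $\mathcal{I}$, and $0\le g(x,A)\le g(0,A)$ for all $x\in\mathcal{P},A\in\mathcal{A}$. (P2) A known $\lambda\ge1$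 satisfies $g(0,A)\le g(x,A)+\lambda c^\top x$ for all $x\in\mathcal{P},A\in\mathcal{A}$. (P3) Known $R$ and $V\le 1$ with $\mathcal{P}\subseteq\{x:\|x\|_2\le R\}$, $\mathcal{P}$ contains a ball of radius $V$, and $\ln(R/V)$ polynomial in $\mathcal{I}$. (P4) For each $A$, $g(\cdot,A)$ is convex on $\mathcal{P}$ and efficiently computable. (P5) For each $x\in\mathcal{P},A$, a subgradient of $g(\cdot,A)$ at $x$ of Euclidean norm at most $K$ is efficiently computable, with $\ln K$ polynomial in $\mathcal{I}$. (P6) A known $\tau\ge1$ with $\ln\tau$ polynomial in $\mathcal{I}$ satisfies $g(x,A')-g(x,A)\le\tau\,\kappa_{sc}(A,A')$ for all $x\in\mathcal{P}$ and all $A,A'$ with $\kappa_{sc}(A,A')>0$. *)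

theory Defs
  imports
    "HOL-Probability.Probability"
    "HOL-Computational_Algebra.Polynomial"
    "Jordan_Normal_Form.Matrix"
begin

text \<open>
  The dimension m of the first-stage space is quantified inside the theorem (the constants
  must not depend on it), so vectors are elements of \<^term>\<open>carrier_vec m\<close> rather than of a
  type-indexed Euclidean space.
\<close>

definition enorm :: "real Matrix.vec \<Rightarrow> real" where
  "enorm x = sqrt (scalar_prod x x)"

definition polytope_in :: "nat \<Rightarrow> real Matrix.vec set \<Rightarrow> bool" where
  "polytope_in m P \<longleftrightarrow>
     (\<exists>n. \<exists>M \<in> carrier_mat n m. \<exists>b \<in> carrier_vec n. P = {x \<in> carrier_vec m. M *\<^sub>v x \<le> b}) \<and>
     (\<exists>B. \<forall>x\<in>P. enorm x \<le> B)"

definition int_points :: "real Matrix.vec set \<Rightarrow> real Matrix.vec set" where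
  "int_points P = {x \<in> P. \<forall>i<dim_vec x. vec_index x i \<in> \<int>}"

definition transport_plans ::
  "'a set \<Rightarrow> ('a \<Rightarrow> 'a \<Rightarrow> real) \<Rightarrow> real \<Rightarrow> 'a pmf \<Rightarrow> ('a \<Rightarrow> 'a \<Rightarrow> real) set" where
  "transport_plans \<A> \<kappa>sc r p =
     {\<gamma>. (\<forall>A\<in>\<A>. \<forall>B\<in>\<A>. 0 \<le> \<gamma> A B) \<and>
         (\<forall>A\<in>\<A>. (\<Sum>B\<in>\<A>. \<gamma> A B) \<le> pmf p A) \<and>
         (\<Sum>A\<in>\<A>. \<Sum>B\<in>\<A>. \<kappa>sc A B * \<gamma> A B) \<le> r}"

text \<open>
  The maximum in the definition of z is over a nonempty compact set (for finite \<A> and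
  \<^prop>\<open>0 \<le> r\<close>), hence equals the supremum.
\<close>

definition robust_recourse ::
  "'a set \<Rightarrow> (real Matrix.vec \<Rightarrow> 'a \<Rightarrow> real) \<Rightarrow> ('a \<Rightarrow> 'a \<Rightarrow> real) \<Rightarrow> real
     \<Rightarrow> 'a pmf \<Rightarrow> real Matrix.vec \<Rightarrow> real" where
  "robust_recourse \<A> g \<kappa>sc r p x =
     (SUP \<gamma> \<in> transport_plans \<A> \<kappa>sc r p. \<Sum>A\<in>\<A>. \<Sum>B\<in>\<A>. \<gamma> A B * g x B)"

definition robust_cost ::
  "real Matrix.vec \<Rightarrow> 'a set \<Rightarrow> (real Matrix.vec \<Rightarrow> 'a \<Rightarrow> real) \<Rightarrow> ('a \<Rightarrow> 'a \<Rightarrow> real) \<Rightarrow> real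
     \<Rightarrow> 'a pmf \<Rightarrow> real Matrix.vec \<Rightarrow> real" where
  "robust_cost c \<A> g \<kappa>sc r p x = scalar_prod c x + robust_recourse \<A> g \<kappa>sc r p x"

text \<open>
  The parameters \<open>sz\<close> and \<open>q\<close> are the input size and a polynomial witnessing the
  requirements of the form ``polynomial in the input size''.  For a single instance those
  requirements are no restriction; they matter only when \<open>q\<close> is shared by a family.
\<close>

locale dr_two_stage =
  fixes m :: nat
    and P :: "real Matrix.vec set"
    and c :: "real Matrix.vec"
    and \<A> :: "'a set"
    and g :: "real Matrix.vec \<Rightarrow> 'a \<Rightarrow> real"
    and \<kappa>sc :: "'a \<Rightarrow> 'a \<Rightarrow> real"
    and r lam R V K \<tau> :: real
    and sz :: nat
    and q :: "real poly"
  assumes finite_scenarios: "finite \<A>"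
    and polytope: "polytope_in m P"
    and nonneg: "\<And>x i. x \<in> P \<Longrightarrow> i < m \<Longrightarrow> 0 \<le> vec_index x i"
    and cost_vec: "c \<in> carrier_vec m"
    and metric: "Metric_space \<A> \<kappa>sc"
    and radius: "0 < r"
    and zero_feasible: "0\<^sub>v m \<in> int_points P"
    and cost_nonneg: "\<And>i. i < m \<Longrightarrow> 0 \<le> vec_index c i"
    and ln_card_X: "ln (real (card (int_points P))) \<le> poly q (real sz)"
    and recourse_bounds:
      "\<And>x A. x \<in> P \<Longrightarrow> A \<in> \<A> \<Longrightarrow> 0 \<le> g x A \<and> g x A \<le> g (0\<^sub>v m) A"
    and inflation_ge_1: "1 \<le> lam"
    and inflation:
      "\<And>x A. x \<in> P \<Longrightarrow> A \<in> \<A> \<Longrightarrow> g (0\<^sub>v m) A \<le> g x A + lam * scalar_prod c x"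
    and inner_radius: "0 < V" "V \<le> 1"
    and outer_ball: "\<And>x. x \<in> P \<Longrightarrow> enorm x \<le> R"
    and inner_ball:
      "\<exists>x0 \<in> carrier_vec m. \<forall>x \<in> carrier_vec m. enorm (x - x0) \<le> V \<longrightarrow> x \<in> P"
    and ln_R_V: "ln (R / V) \<le> poly q (real sz)"
    and convex:
      "\<And>x y A t. x \<in> P \<Longrightarrow> y \<in> P \<Longrightarrow> A \<in> \<A> \<Longrightarrow> 0 \<le> t \<Longrightarrow> t \<le> 1 \<Longrightarrow>
         g ((1 - t) \<cdot>\<^sub>v x + t \<cdot>\<^sub>v y) A \<le> (1 - t) * g x A + t * g y A"
    and subgradient_bound: "0 < K"
    and subgradient:
      "\<And>x A. x \<in> P \<Longrightarrow> A \<in> \<A> \<Longrightarrow>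
         \<exists>d \<in> carrier_vec m. enorm d \<le> K \<and>
           (\<forall>y\<in>P. g x A + scalar_prod d (y - x) \<le> g y A)"
    and ln_K: "ln K \<le> poly q (real sz)"
    and tau_ge_1: "1 \<le> \<tau>"
    and ln_tau: "ln \<tau> \<le> poly q (real sz)"
    and lipschitz:
      "\<And>x A B. x \<in> P \<Longrightarrow> A \<in> \<A> \<Longrightarrow> B \<in> \<A> \<Longrightarrow> 0 < \<kappa>sc A B \<Longrightarrow>
         g x B - g x A \<le> \<tau> * \<kappa>sc A B"

definition empirical :: "nat \<Rightarrow> (nat \<Rightarrow> 'a) \<Rightarrow> 'a pmf" where
  "empirical N s = map_pmf s (pmf_of_set {1..N})"

text \<open>
  \<open>quad_poly d a\<close> is the real polynomial in four variables with coefficients \<open>a\<close> and degree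
  at most \<open>d\<close> in each variable.
\<close>

definition quad_poly ::
  "nat \<Rightarrow> (nat \<Rightarrow> nat \<Rightarrow> nat \<Rightarrow> nat \<Rightarrow> real) \<Rightarrow> real \<Rightarrow> real \<Rightarrow> real \<Rightarrow> real \<Rightarrow> real" where
  "quad_poly d a u v w z =
     (\<Sum>i\<le>d. \<Sum>j\<le>d. \<Sum>k\<le>d. \<Sum>l\<le>d. a i j k l * u ^ i * v ^ j * w ^ k * z ^ l)"

end

theory Submission
  imports Defs
begin

text \<open>
  Write \<open>G t x A\<close> for the maximum over \<open>B\<close> of \<open>g x B - t * \<kappa>sc A B\<close>.  Then
  \<open>min (r * t) (E\<^sub>p (G t x)) \<le> z\<^sub>p x \<le> r * t + E\<^sub>p (G t x)\<close> for all \<open>t \<ge> 0\<close>.  Choosing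
  \<open>t = z\<^sub>p x / (2 * r)\<close>, a lower estimate of the single number \<open>E\<^sub>p (G t x)\<close> from the sample
  \<open>p'\<close> yields \<open>z\<^sub>p x \<le> 2 * z\<^sub>p\<^sub>' x\<close> up to the estimation error, so one value of \<open>t\<close> for each \<open>x\<close>
  suffices in the union bound.  The tail of \<open>G t x\<close> above \<open>\<lambda> * OPT\<close> is
  dominated by \<open>G t x\<^sub>0\<close> for an optimal \<open>x\<^sub>0\<close>, hence costs at most \<open>OPT\<close> in expectation (unless
  already \<open>z\<^sub>p x \<le> 2 * z\<^sub>p x\<^sub>0\<close>), and the truncated part is controlled by Hoeffding's inequality.
  Since \<open>z\<close> is concave in the distribution, the empirical cost of \<open>x\<^sub>0\<close> has mean at most \<open>OPT\<close>, and
  by Markov's inequality one of the \<open>k\<close> independent samples has empirical optimum at most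
  \<open>(1 + \<epsilon>) * OPT\<close>.  Working with \<open>OPT + \<kappa>/4\<close> instead of \<open>OPT\<close> avoids the degenerate case
  \<open>OPT = 0\<close>.
\<close>

section \<open>Finitely supported distributions and products of independent samples\<close>

lemma expectation_finite_superset:
  assumes "finite S" "set_pmf p \<subseteq> S"
  shows "measure_pmf.expectation p f = (\<Sum>A\<in>S. pmf p A * (f A :: real))"
  using assms by (subst integral_measure_pmf[of S]) auto

lemma expectation_mono_finite:
  fixes f f' :: "'a \<Rightarrow> real"
  assumes "finite S" "set_pmf p \<subseteq> S" "\<And>A. A \<in> S \<Longrightarrow> f A \<le> f' A"
  shows "measure_pmf.expectation p f \<le> measure_pmf.expectation p f'"
  using assms by (simp add: expectation_finite_superset sum_mono mult_left_mono)

text \<open>Cutting both factors down to the supports changes no probability and makes them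
  countable, as \<open>measure_pmf_prob_product\<close> requires.\<close>

lemma prob_pair_pmf_Times:
  assumes "finite (set_pmf p)" "finite (set_pmf q)"
  shows "measure_pmf.prob (pair_pmf p q) (S \<times> T) = measure_pmf.prob p S * measure_pmf.prob q T"
proof -
  have "measure_pmf.prob (pair_pmf p q) (S \<times> T) =
      measure_pmf.prob (pair_pmf p q) ((S \<inter> set_pmf p) \<times> (T \<inter> set_pmf q))"
    by (intro measure_prob_cong_0) (auto simp: pmf_pair set_pmf_eq)
  also have "\<dots> = measure_pmf.prob p (S \<inter> set_pmf p) * measure_pmf.prob q (T \<inter> set_pmf q)"
    using assms by (intro measure_pmf_prob_product) (auto simp: countable_finite)
  finally show ?thesis by (simp add: measure_Int_set_pmf)
qed

lemma finite_set_Pi_pmf: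
  assumes "finite I" "\<And>i. i \<in> I \<Longrightarrow> finite (set_pmf (p i))"
  shows "finite (set_pmf (Pi_pmf I d p))"
  using assms by (simp add: set_Pi_pmf finite_PiE_dflt)

text \<open>Independence across blocks in the form used for the \<open>k\<close> trials. The
  assumption \<open>local\<close> says that \<open>Q i\<close> sees only the coordinates in block
  \<open>i\<close>; splitting one block off the product therefore turns the joint event into a
  rectangle, and only a bound for a single block is needed.\<close>

lemma prob_Pi_pmf_all_blocks_le:
  fixes p :: "'a pmf" and J :: "'j set" and I :: "'i set"
  assumes "finite I" "finite J" "finite (set_pmf p)" "0 \<le> b"
    and local: "\<And>i \<omega> \<omega>'. i \<in> I \<Longrightarrow> (\<And>j. j \<in> J \<Longrightarrow> \<omega> (i, j) = \<omega>' (i, j)) \<Longrightarrow> Q i \<omega> \<longleftrightarrow> Q i \<omega>'"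
    and bound: "\<And>i. i \<in> I \<Longrightarrow> measure_pmf.prob (Pi_pmf ({i} \<times> J) d (\<lambda>_. p)) {\<omega>. Q i \<omega>} \<le> b"
  shows "measure_pmf.prob (Pi_pmf (I \<times> J) d (\<lambda>_. p)) {\<omega>. \<forall>i\<in>I. Q i \<omega>} \<le> b ^ card I"
  using assms(1) local bound
proof (induction I rule: finite_induct)
  case empty
  then show ?case by simp
next
  case (insert i I)
  let ?W1 = "Pi_pmf ({i} \<times> J) d (\<lambda>_. p)" and ?W2 = "Pi_pmf (I \<times> J) d (\<lambda>_. p)"
  let ?S = "{\<omega>. Q i \<omega>}" and ?T = "{\<omega>. \<forall>i\<in>I. Q i \<omega>}"
  let ?join = "\<lambda>(\<omega>1, \<omega>2) y. if y \<in> {i} \<times> J then \<omega>1 y else \<omega>2 y"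
  have split: "insert i I \<times> J = ({i} \<times> J) \<union> (I \<times> J)" by auto
  have W: "Pi_pmf (insert i I \<times> J) d (\<lambda>_. p) = map_pmf ?join (pair_pmf ?W1 ?W2)"
    unfolding split using insert.hyps \<open>finite J\<close> by (intro Pi_pmf_union) auto
  have "Q i (?join (\<omega>1, \<omega>2)) \<longleftrightarrow> Q i \<omega>1" for \<omega>1 \<omega>2
    by (intro insert.prems(1)) auto
  moreover have "Q i' (?join (\<omega>1, \<omega>2)) \<longleftrightarrow> Q i' \<omega>2" if "i' \<in> I" for i' \<omega>1 \<omega>2
    using that insert.hyps by (intro insert.prems(1)) auto
  ultimately have "?join -` {\<omega>. \<forall>i\<in>insert i I. Q i \<omega>} = ?S \<times> ?T"
    by auto
  then have "measure_pmf.prob (Pi_pmf (insert i I \<times> J) d (\<lambda>_. p)) {\<omega>. \<forall>i\<in>insert i I. Q i \<omega>} =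
      measure_pmf.prob (pair_pmf ?W1 ?W2) (?S \<times> ?T)"
    unfolding W by (simp only: measure_map_pmf)
  also have "\<dots> = measure_pmf.prob ?W1 ?S * measure_pmf.prob ?W2 ?T"
    using insert.hyps assms(2,3) by (intro prob_pair_pmf_Times finite_set_Pi_pmf) auto
  also have "\<dots> \<le> b * b ^ card I"
  proof (rule mult_mono)
    show "measure_pmf.prob ?W1 ?S \<le> b" by (rule insert.prems(2)) simp
    show "measure_pmf.prob ?W2 ?T \<le> b ^ card I"
    proof (rule insert.IH)
      show "Q i' \<omega> \<longleftrightarrow> Q i' \<omega>'" if "i' \<in> I" "\<And>j. j \<in> J \<Longrightarrow> \<omega> (i', j) = \<omega>' (i', j)" for i' \<omega> \<omega>'
        by (rule insert.prems(1)) (use that in auto)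
      show "measure_pmf.prob (Pi_pmf ({i'} \<times> J) d (\<lambda>_. p)) {\<omega>. Q i' \<omega>} \<le> b" if "i' \<in> I" for i'
        by (rule insert.prems(2)) (use that in auto)
    qed
  qed (use \<open>0 \<le> b\<close> in auto)
  finally show ?case using insert.hyps by simp
qed

text \<open>The coordinates in \<open>J\<close> are independent with law \<open>p\<close>, so
  Hoeffding's inequality applies to the sum with deviation \<open>card J * e\<close> and ranges
  \<open>{0..b}\<close>. Dividing by \<open>card J\<close> gives the form for the average.\<close>

lemma hoeffding_lower_tail_Pi_pmf:
  fixes F :: "'a \<Rightarrow> real" and b e :: real
  assumes "finite I" "J \<subseteq> I" "J \<noteq> {}" "0 < b" "0 \<le> e"
    and F: "\<And>A. A \<in> set_pmf p \<Longrightarrow> 0 \<le> F A \<and> F A \<le> b"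
  shows "measure_pmf.prob (Pi_pmf I d (\<lambda>_. p))
           {\<omega>. (\<Sum>j\<in>J. F (\<omega> j)) / card J \<le> measure_pmf.expectation p F - e}
         \<le> exp (- 2 * real (card J) * e\<^sup>2 / b\<^sup>2)"
proof -
  let ?W = "Pi_pmf I d (\<lambda>_. p)"
  have finJ: "finite J" using assms finite_subset by blast
  have comp: "map_pmf (\<lambda>\<omega>. \<omega> j) ?W = p" if "j \<in> J" for j
    using that assms by (subst Pi_pmf_component) auto
  have ind: "prob_space.indep_vars ?W (\<lambda>_. borel) (\<lambda>j \<omega>. F (\<omega> j)) J"
    using prob_space.indep_vars_subset[OF measure_pmf.prob_space_axioms
        prob_space.indep_vars_compose2[OF measure_pmf.prob_space_axioms
          indep_vars_Pi_pmf[OF \<open>finite I\<close>], of "\<lambda>_. F" "\<lambda>_. borel"]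
        \<open>J \<subseteq> I\<close>] by simp
  have mean: "measure_pmf.expectation ?W (\<lambda>\<omega>. F (\<omega> j)) = measure_pmf.expectation p F" if "j \<in> J" for j
    using comp[OF that] by (metis integral_map_pmf)
  have rng: "F (\<omega> j) \<in> {0..b}" if "j \<in> J" "\<omega> \<in> set_pmf ?W" for j \<omega>
    using F[of "\<omega> j"] comp[OF that(1)] that by (metis atLeastAtMost_iff imageI set_map_pmf)
  interpret Hoeffding_ineq ?W J "\<lambda>j \<omega>. F (\<omega> j)" "\<lambda>_. 0" "\<lambda>_. b"
      "\<Sum>j\<in>J. measure_pmf.expectation ?W (\<lambda>\<omega>. F (\<omega> j))"
    by unfold_locales (use ind finJ rng in \<open>auto simp: AE_measure_pmf_iff\<close>)
  have n: "0 < real (card J)" using finJ assms by (simp add: card_gt_0_iff)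
  have "measure_pmf.prob ?W
          {\<omega>. (\<Sum>j\<in>J. F (\<omega> j)) \<le> card J * measure_pmf.expectation p F - card J * e}
        \<le> exp (- 2 * (real (card J) * e)\<^sup>2 / (card J * b\<^sup>2))"
    using Hoeffding_ineq_le[of "card J * e"] n assms mean by simp
  also have "- 2 * (real (card J) * e)\<^sup>2 / (card J * b\<^sup>2) = - 2 * real (card J) * e\<^sup>2 / b\<^sup>2"
    using n by (simp add: power2_eq_square)
  also have "{\<omega>. (\<Sum>j\<in>J. F (\<omega> j)) \<le> card J * measure_pmf.expectation p F - card J * e} =
      {\<omega>. (\<Sum>j\<in>J. F (\<omega> j)) / card J \<le> measure_pmf.expectation p F - e}"
    using n by (simp add: field_simps)
  finally show ?thesis .
qed

section \<open>Empirical distributions\<close>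

lemma expectation_empirical:
  assumes "0 < N"
  shows "measure_pmf.expectation (empirical N s) F = (\<Sum>l=1..N. F (s l) :: real) / N"
  using assms by (simp add: empirical_def integral_pmf_of_set)

lemma set_empirical: "0 < N \<Longrightarrow> set_pmf (empirical N s) = s ` {1..N}"
  by (simp add: empirical_def set_pmf_of_set)

lemma empirical_cong:
  assumes "0 < N" "\<And>l. l \<in> {1..N} \<Longrightarrow> s l = s' l"
  shows "empirical N s = empirical N s'"
  unfolding empirical_def using assms by (intro map_pmf_cong) (auto simp: set_pmf_of_set)

text \<open>The empirical distribution is \<open>p\<close> on average: drawing the index
  \<open>l\<close> before the samples, one is left with the single coordinate \<open>(i, l)\<close>,
  whose law is \<open>p\<close>.\<close>

lemma bind_empirical:
  assumes "0 < N" "finite I" "{i} \<times> {1..N} \<subseteq> I"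
  shows "bind_pmf (Pi_pmf I d (\<lambda>_. p)) (\<lambda>\<omega>. empirical N (\<lambda>l. \<omega> (i, l))) = p"
proof -
  have "bind_pmf (Pi_pmf I d (\<lambda>_. p)) (\<lambda>\<omega>. empirical N (\<lambda>l. \<omega> (i, l))) =
      bind_pmf (pmf_of_set {1..N}) (\<lambda>l. map_pmf (\<lambda>\<omega>. \<omega> (i, l)) (Pi_pmf I d (\<lambda>_. p)))"
    unfolding empirical_def map_pmf_def by (rule bind_commute_pmf)
  also have "\<dots> = bind_pmf (pmf_of_set {1..N}) (\<lambda>_. p)"
  proof (intro bind_pmf_cong refl)
    fix l assume "l \<in> set_pmf (pmf_of_set {1..N})"
    then have "(i, l) \<in> I" using assms by (auto simp: set_pmf_of_set)
    then show "map_pmf (\<lambda>\<omega>. \<omega> (i, l)) (Pi_pmf I d (\<lambda>_. p)) = p"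
      using assms(2) by (simp add: Pi_pmf_component)
  qed
  finally show ?thesis by simp
qed

section \<open>Basic facts on feasible decisions, costs and the scenario metric\<close>

context dr_two_stage
begin

abbreviation "X \<equiv> int_points P"
abbreviation "z \<equiv> robust_recourse \<A> g \<kappa>sc r"
abbreviation "h \<equiv> robust_cost c \<A> g \<kappa>sc r"

text \<open>This is \<open>G t x A\<close> of the overview: the transport budget is relaxed with
  Lagrange multiplier \<open>t\<close>, after which each scenario moves on its own.\<close>

definition penalised_recourse :: "real \<Rightarrow> real Matrix.vec \<Rightarrow> 'a \<Rightarrow> real" where
  "penalised_recourse t x A = Max ((\<lambda>B. g x B - t * \<kappa>sc A B) ` \<A>)"

lemma X_subset: "X \<subseteq> P"
  by (auto simp: int_points_def)

lemma P_carrier: "P \<subseteq> carrier_vec m"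
  using polytope by (auto simp: polytope_in_def)

text \<open>Each coordinate is an integer of absolute value at most \<open>R\<close>, because it is
  bounded by the Euclidean norm.\<close>

lemma finite_X: "finite X"
proof -
  let ?S = "{a \<in> \<int>. \<bar>a\<bar> \<le> R}"
  have "x \<in> Matrix.vec m ` ({0..<m} \<rightarrow>\<^sub>E ?S)" if x: "x \<in> X" for x
  proof -
    have xP: "x \<in> P" using x X_subset by blast
    then have dim: "dim_vec x = m" using P_carrier by auto
    have "\<bar>vec_index x i\<bar> \<le> R" if "i < m" for i
    proof -
      have "vec_index x i * vec_index x i \<le> scalar_prod x x"
        unfolding scalar_prod_def dim
        using that by (intro member_le_sum) auto
      then have "sqrt ((vec_index x i)\<^sup>2) \<le> enorm x"
        unfolding enorm_def power2_eq_square by (rule real_sqrt_le_mono)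
      then show ?thesis using outer_ball[OF xP] by simp
    qed
    moreover have "x = Matrix.vec m (restrict (vec_index x) {0..<m})"
      using dim by (intro eq_vecI) auto
    ultimately show ?thesis
      using x dim by (intro image_eqI[where x = "restrict (vec_index x) {0..<m}"])
        (auto simp: int_points_def)
  qed
  then have "X \<subseteq> Matrix.vec m ` ({0..<m} \<rightarrow>\<^sub>E ?S)" by blast
  moreover have "finite (Matrix.vec m ` ({0..<m} \<rightarrow>\<^sub>E ?S))"
    by (intro finite_imageI finite_PiE) (auto simp: finite_abs_int_segment)
  ultimately show ?thesis by (rule finite_subset)
qed

lemma first_stage_cost_nonneg: "x \<in> P \<Longrightarrow> 0 \<le> scalar_prod c x"
  using P_carrier nonneg cost_nonneg unfolding scalar_prod_def
  by (intro sum_nonneg mult_nonneg_nonneg) auto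

lemma dist_nonneg: "0 \<le> \<kappa>sc A B"
  using metric by (rule Metric_space.nonneg)

lemma dist_self: "A \<in> \<A> \<Longrightarrow> \<kappa>sc A A = 0"
  using metric by (simp add: Metric_space.zero)

section \<open>Penalised recourse and approximate duality\<close>

lemma penalised_recourse_ge:
  "B \<in> \<A> \<Longrightarrow> g x B - t * \<kappa>sc A B \<le> penalised_recourse t x A"
  unfolding penalised_recourse_def using finite_scenarios by (intro Max_ge) auto

lemma penalised_recourse_attained:
  assumes "A \<in> \<A>"
  obtains B where "B \<in> \<A>" "penalised_recourse t x A = g x B - t * \<kappa>sc A B"
proof -
  have "penalised_recourse t x A \<in> (\<lambda>B. g x B - t * \<kappa>sc A B) ` \<A>"
    unfolding penalised_recourse_def using finite_scenarios assms by (intro Max_in) auto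
  then show ?thesis using that by auto
qed

text \<open>Staying at \<open>B = A\<close> incurs no penalty.\<close>

lemma penalised_recourse_nonneg:
  assumes "x \<in> P" "A \<in> \<A>"
  shows "0 \<le> penalised_recourse t x A"
  using penalised_recourse_ge[of A x t A] recourse_bounds[of x A] dist_self[of A] assms by auto

text \<open>At the maximiser \<open>B\<close> for \<open>x\<close>, passing through
  \<open>g (0\<^sub>v m) B\<close> compares \<open>g x B\<close> with \<open>g x0 B\<close>, and the
  penalty is the same on both sides. The gap does not depend on \<open>x\<close>, which is what
  permits one truncation level for all decisions.\<close>

lemma penalised_recourse_inflation:
  assumes "x \<in> P" "x0 \<in> P" "A \<in> \<A>"
  shows "penalised_recourse t x A \<le> penalised_recourse t x0 A + lam * scalar_prod c x0"
proof -
  obtain B where B: "B \<in> \<A>" "penalised_recourse t x A = g x B - t * \<kappa>sc A B"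
    using penalised_recourse_attained assms(3) by blast
  then show ?thesis
    using recourse_bounds[of x B] inflation[of x0 B] penalised_recourse_ge[of B x0 t A] assms by auto
qed

text \<open>Weak duality. Row sums of \<open>\<gamma>\<close> may be strictly below
  \<open>pmf p A\<close>, so nonnegativity of the penalised recourse enters when they are replaced
  by it.\<close>

lemma plan_value_le_dual:
  assumes "\<gamma> \<in> transport_plans \<A> \<kappa>sc r p" "set_pmf p \<subseteq> \<A>" "x \<in> P" "0 \<le> t"
  shows "(\<Sum>A\<in>\<A>. \<Sum>B\<in>\<A>. \<gamma> A B * g x B) \<le> r * t + measure_pmf.expectation p (penalised_recourse t x)"
proof -
  have \<gamma>: "0 \<le> \<gamma> A B" "(\<Sum>B\<in>\<A>. \<gamma> A B) \<le> pmf p A" if "A \<in> \<A>" "B \<in> \<A>" for A B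
    using assms(1) that by (auto simp: transport_plans_def)
  have budget: "(\<Sum>A\<in>\<A>. \<Sum>B\<in>\<A>. \<kappa>sc A B * \<gamma> A B) \<le> r"
    using assms(1) by (auto simp: transport_plans_def)
  have "(\<Sum>A\<in>\<A>. \<Sum>B\<in>\<A>. \<gamma> A B * g x B) \<le>
      (\<Sum>A\<in>\<A>. \<Sum>B\<in>\<A>. \<gamma> A B * penalised_recourse t x A + t * (\<kappa>sc A B * \<gamma> A B))"
  proof (intro sum_mono)
    fix A B assume "A \<in> \<A>" "B \<in> \<A>"
    then have "\<gamma> A B * (g x B - t * \<kappa>sc A B) \<le> \<gamma> A B * penalised_recourse t x A"
      by (intro mult_left_mono penalised_recourse_ge \<gamma>)
    then show "\<gamma> A B * g x B \<le> \<gamma> A B * penalised_recourse t x A + t * (\<kappa>sc A B * \<gamma> A B)"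
      by (simp add: algebra_simps)
  qed
  also have "\<dots> = (\<Sum>A\<in>\<A>. (\<Sum>B\<in>\<A>. \<gamma> A B) * penalised_recourse t x A) +
      t * (\<Sum>A\<in>\<A>. \<Sum>B\<in>\<A>. \<kappa>sc A B * \<gamma> A B)"
    by (simp add: sum.distrib sum_distrib_left sum_distrib_right)
  also have "\<dots> \<le> (\<Sum>A\<in>\<A>. pmf p A * penalised_recourse t x A) + t * r"
    using assms by (intro add_mono sum_mono mult_right_mono mult_left_mono \<gamma> budget
        penalised_recourse_nonneg) auto
  finally show ?thesis
    using assms finite_scenarios by (simp add: expectation_finite_superset mult.commute)
qed

lemma zero_plan: "(\<lambda>_ _. 0) \<in> transport_plans \<A> \<kappa>sc r p"
  using radius by (simp add: transport_plans_def)

lemma robust_recourse_le_dual: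
  assumes "set_pmf p \<subseteq> \<A>" "x \<in> P" "0 \<le> t"
  shows "z p x \<le> r * t + measure_pmf.expectation p (penalised_recourse t x)"
  unfolding robust_recourse_def
  using zero_plan by (intro cSUP_least plan_value_le_dual assms) auto

lemma plan_value_le_robust_recourse:
  assumes "\<gamma> \<in> transport_plans \<A> \<kappa>sc r p" "set_pmf p \<subseteq> \<A>" "x \<in> P"
  shows "(\<Sum>A\<in>\<A>. \<Sum>B\<in>\<A>. \<gamma> A B * g x B) \<le> z p x"
  unfolding robust_recourse_def
  using assms(1)
proof (intro cSUP_upper bdd_aboveI2)
  \<comment> \<open>Weak duality with multiplier 0 bounds all plan values, so the supremum is a
    genuine one.\<close>
  show "(\<Sum>A\<in>\<A>. \<Sum>B\<in>\<A>. \<gamma>' A B * g x B) \<le> r * 0 + measure_pmf.expectation p (penalised_recourse 0 x)"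
    if "\<gamma>' \<in> transport_plans \<A> \<kappa>sc r p" for \<gamma>'
    using assms(2,3) by (intro plan_value_le_dual that) auto
qed

lemma robust_recourse_nonneg:
  "set_pmf p \<subseteq> \<A> \<Longrightarrow> x \<in> P \<Longrightarrow> 0 \<le> z p x"
  using plan_value_le_robust_recourse[OF zero_plan] by simp

text \<open>Move each scenario to its penalised maximiser; if this exceeds the budget, scale the plan
  down, and the part of the value paid for by the penalty is then still \<open>r * t\<close>.\<close>

lemma min_dual_le_robust_recourse:
  assumes "set_pmf p \<subseteq> \<A>" "x \<in> P" "0 \<le> t"
  shows "min (r * t) (measure_pmf.expectation p (penalised_recourse t x)) \<le> z p x"
proof -
  have "\<exists>B. B \<in> \<A> \<and> penalised_recourse t x A = g x B - t * \<kappa>sc A B" if "A \<in> \<A>" for A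
    using penalised_recourse_attained[OF that] by metis
  then obtain \<pi> where \<pi>: "\<And>A. A \<in> \<A> \<Longrightarrow> \<pi> A \<in> \<A>"
      "\<And>A. A \<in> \<A> \<Longrightarrow> penalised_recourse t x A = g x (\<pi> A) - t * \<kappa>sc A (\<pi> A)"
    by metis
  define D where "D = (\<Sum>A\<in>\<A>. pmf p A * \<kappa>sc A (\<pi> A))"
  define E where "E = (\<Sum>A\<in>\<A>. pmf p A * penalised_recourse t x A)"
  have E: "measure_pmf.expectation p (penalised_recourse t x) = E"
    using assms finite_scenarios by (simp add: expectation_finite_superset E_def)
  have E0: "0 \<le> E" unfolding E_def
    using assms by (intro sum_nonneg mult_nonneg_nonneg penalised_recourse_nonneg) auto
  have D0: "0 \<le> D" unfolding D_def
    by (intro sum_nonneg mult_nonneg_nonneg dist_nonneg) auto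
  have val: "(\<Sum>A\<in>\<A>. pmf p A * g x (\<pi> A)) = E + t * D"
    unfolding E_def D_def sum_distrib_left
    by (simp add: \<pi>(2) sum.distrib[symmetric] algebra_simps)
  \<comment> \<open>The fraction \<open>s\<close> of moved mass stays free here;
    \<open>s = 1\<close> serves when the transport cost \<open>D\<close> fits the budget, and
    \<open>s = r / D\<close> otherwise.\<close>
  have scaled: "s * (E + t * D) \<le> z p x" if s: "0 \<le> s" "s \<le> 1" "s * D \<le> r" for s
  proof -
    define \<gamma> where "\<gamma> A B = (if B = \<pi> A then s * pmf p A else 0)" for A B
    have sum_\<gamma>: "(\<Sum>B\<in>\<A>. \<gamma> A B * F B) = s * pmf p A * F (\<pi> A)" if "A \<in> \<A>" for A and F :: "'a \<Rightarrow> real"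
    proof -
      have "(\<Sum>B\<in>\<A>. \<gamma> A B * F B) = (\<Sum>B\<in>\<A>. if B = \<pi> A then s * pmf p A * F (\<pi> A) else 0)"
        by (intro sum.cong) (auto simp: \<gamma>_def)
      then show ?thesis using finite_scenarios \<pi>(1)[OF that] by simp
    qed
    have "\<gamma> \<in> transport_plans \<A> \<kappa>sc r p"
      unfolding transport_plans_def
    proof (intro CollectI conjI ballI)
      fix A assume A: "A \<in> \<A>"
      show "(\<Sum>B\<in>\<A>. \<gamma> A B) \<le> pmf p A"
        using sum_\<gamma>[OF A, of "\<lambda>_. 1"] s by (simp add: mult_left_le_one_le)
    next
      have "(\<Sum>A\<in>\<A>. \<Sum>B\<in>\<A>. \<kappa>sc A B * \<gamma> A B) = (\<Sum>A\<in>\<A>. s * pmf p A * \<kappa>sc A (\<pi> A))"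
        using sum_\<gamma> by (intro sum.cong refl) (simp add: mult.commute[of "\<kappa>sc _ _"])
      also have "\<dots> = s * D" by (simp add: D_def sum_distrib_left mult.assoc)
      finally show "(\<Sum>A\<in>\<A>. \<Sum>B\<in>\<A>. \<kappa>sc A B * \<gamma> A B) \<le> r" using s by simp
    qed (use s in \<open>auto simp: \<gamma>_def\<close>)
    then have "(\<Sum>A\<in>\<A>. \<Sum>B\<in>\<A>. \<gamma> A B * g x B) \<le> z p x"
      using assms by (intro plan_value_le_robust_recourse)
    moreover have "(\<Sum>A\<in>\<A>. \<Sum>B\<in>\<A>. \<gamma> A B * g x B) = s * (E + t * D)"
      using sum_\<gamma> by (simp add: val[symmetric] sum_distrib_left mult.assoc)
    ultimately show ?thesis by simp
  qed
  show ?thesis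
  proof (cases "D \<le> r")
    case True
    then have "E + t * D \<le> z p x" using scaled[of 1] by simp
    moreover have "0 \<le> t * D" using assms(3) D0 by simp
    ultimately show ?thesis using E by linarith
  next
    case False
    then have "(r / D) * (E + t * D) \<le> z p x" using radius by (intro scaled) auto
    moreover have "(r / D) * (E + t * D) = (r / D) * E + r * t"
      using False radius by (simp add: field_simps)
    moreover have "0 \<le> (r / D) * E" using E0 D0 radius by simp
    ultimately show ?thesis by linarith
  qed
qed

text \<open>Averaging near-optimal plans for the components gives a feasible plan for the mixture.\<close>

lemma expectation_robust_recourse_le:
  assumes W: "finite (set_pmf W)" and Q: "\<And>\<omega>. \<omega> \<in> set_pmf W \<Longrightarrow> set_pmf (Q \<omega>) \<subseteq> \<A>"
    and x: "x \<in> P"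
  shows "measure_pmf.expectation W (\<lambda>\<omega>. z (Q \<omega>) x) \<le> z (bind_pmf W Q) x"
proof (rule field_le_epsilon)
  fix e :: real assume e: "0 < e"
  let ?S = "set_pmf W"
  \<comment> \<open>Plans within \<open>e\<close> of the supremum avoid any appeal to attainment by
    compactness.\<close>
  have "\<exists>\<gamma>. \<gamma> \<in> transport_plans \<A> \<kappa>sc r (Q \<omega>) \<and>
      z (Q \<omega>) x - e \<le> (\<Sum>A\<in>\<A>. \<Sum>B\<in>\<A>. \<gamma> A B * g x B)" if "\<omega> \<in> ?S" for \<omega>
  proof (rule ccontr)
    assume no: "\<not> ?thesis"
    have "(SUP \<gamma>\<in>transport_plans \<A> \<kappa>sc r (Q \<omega>). \<Sum>A\<in>\<A>. \<Sum>B\<in>\<A>. \<gamma> A B * g x B) \<le> z (Q \<omega>) x - e"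
    proof (rule cSUP_least)
      fix \<gamma> assume "\<gamma> \<in> transport_plans \<A> \<kappa>sc r (Q \<omega>)"
      then show "(\<Sum>A\<in>\<A>. \<Sum>B\<in>\<A>. \<gamma> A B * g x B) \<le> z (Q \<omega>) x - e"
        using no by (meson linear)
    qed (use zero_plan in auto)
    then have "z (Q \<omega>) x \<le> z (Q \<omega>) x - e"
      by (simp only: robust_recourse_def)
    then show False using e by simp
  qed
  then obtain \<Gamma> where \<Gamma>: "\<And>\<omega>. \<omega> \<in> ?S \<Longrightarrow> \<Gamma> \<omega> \<in> transport_plans \<A> \<kappa>sc r (Q \<omega>)"
      "\<And>\<omega>. \<omega> \<in> ?S \<Longrightarrow> z (Q \<omega>) x - e \<le> (\<Sum>A\<in>\<A>. \<Sum>B\<in>\<A>. \<Gamma> \<omega> A B * g x B)"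
    by metis
  have sum1: "(\<Sum>\<omega>\<in>?S. pmf W \<omega>) = 1" using W by (simp add: sum_pmf_eq_1)
  have expW: "measure_pmf.expectation W f = (\<Sum>\<omega>\<in>?S. pmf W \<omega> * f \<omega>)" for f :: "_ \<Rightarrow> real"
    using W by (simp add: expectation_finite_superset)
  define \<gamma> where "\<gamma> A B = (\<Sum>\<omega>\<in>?S. pmf W \<omega> * \<Gamma> \<omega> A B)" for A B
  have avg: "(\<Sum>A\<in>\<A>. \<Sum>B\<in>\<A>. \<gamma> A B * F A B) =
      (\<Sum>\<omega>\<in>?S. pmf W \<omega> * (\<Sum>A\<in>\<A>. \<Sum>B\<in>\<A>. \<Gamma> \<omega> A B * F A B))" for F :: "'a \<Rightarrow> 'a \<Rightarrow> real"
  proof -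
    have "(\<Sum>A\<in>\<A>. \<Sum>B\<in>\<A>. \<gamma> A B * F A B) =
        (\<Sum>A\<in>\<A>. \<Sum>B\<in>\<A>. \<Sum>\<omega>\<in>?S. pmf W \<omega> * (\<Gamma> \<omega> A B * F A B))"
      by (simp add: \<gamma>_def sum_distrib_right mult.assoc)
    also have "\<dots> = (\<Sum>A\<in>\<A>. \<Sum>\<omega>\<in>?S. \<Sum>B\<in>\<A>. pmf W \<omega> * (\<Gamma> \<omega> A B * F A B))"
      by (intro sum.cong refl sum.swap)
    also have "\<dots> = (\<Sum>\<omega>\<in>?S. \<Sum>A\<in>\<A>. \<Sum>B\<in>\<A>. pmf W \<omega> * (\<Gamma> \<omega> A B * F A B))"
      by (rule sum.swap)
    finally show ?thesis by (simp add: sum_distrib_left)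
  qed
  have "\<gamma> \<in> transport_plans \<A> \<kappa>sc r (bind_pmf W Q)"
    unfolding transport_plans_def
  proof (intro CollectI conjI ballI)
    fix A B assume "A \<in> \<A>" "B \<in> \<A>"
    then show "0 \<le> \<gamma> A B"
      unfolding \<gamma>_def using \<Gamma>(1) by (intro sum_nonneg mult_nonneg_nonneg) (auto simp: transport_plans_def)
  next
    fix A assume A: "A \<in> \<A>"
    have "(\<Sum>B\<in>\<A>. \<gamma> A B) = (\<Sum>\<omega>\<in>?S. \<Sum>B\<in>\<A>. pmf W \<omega> * \<Gamma> \<omega> A B)"
      unfolding \<gamma>_def by (rule sum.swap)
    also have "\<dots> = (\<Sum>\<omega>\<in>?S. pmf W \<omega> * (\<Sum>B\<in>\<A>. \<Gamma> \<omega> A B))"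
      by (simp add: sum_distrib_left)
    also have "\<dots> \<le> (\<Sum>\<omega>\<in>?S. pmf W \<omega> * pmf (Q \<omega>) A)"
      using \<Gamma>(1) A by (intro sum_mono mult_left_mono) (auto simp: transport_plans_def)
    also have "\<dots> = pmf (bind_pmf W Q) A" by (simp add: pmf_bind expW)
    finally show "(\<Sum>B\<in>\<A>. \<gamma> A B) \<le> pmf (bind_pmf W Q) A" .
  next
    have "(\<Sum>A\<in>\<A>. \<Sum>B\<in>\<A>. \<kappa>sc A B * \<gamma> A B) =
        (\<Sum>\<omega>\<in>?S. pmf W \<omega> * (\<Sum>A\<in>\<A>. \<Sum>B\<in>\<A>. \<kappa>sc A B * \<Gamma> \<omega> A B))"
      using avg[of \<kappa>sc] by (simp add: mult.commute[of "\<kappa>sc _ _"])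
    also have "\<dots> \<le> (\<Sum>\<omega>\<in>?S. pmf W \<omega> * r)"
      using \<Gamma>(1) by (intro sum_mono mult_left_mono) (auto simp: transport_plans_def)
    also have "\<dots> = r" by (simp add: sum1 flip: sum_distrib_right)
    finally show "(\<Sum>A\<in>\<A>. \<Sum>B\<in>\<A>. \<kappa>sc A B * \<gamma> A B) \<le> r" .
  qed
  moreover have "set_pmf (bind_pmf W Q) \<subseteq> \<A>" using Q by auto
  ultimately have "(\<Sum>A\<in>\<A>. \<Sum>B\<in>\<A>. \<gamma> A B * g x B) \<le> z (bind_pmf W Q) x"
    using x by (intro plan_value_le_robust_recourse)
  moreover have "measure_pmf.expectation W (\<lambda>\<omega>. z (Q \<omega>) x) - e =
      (\<Sum>\<omega>\<in>?S. pmf W \<omega> * (z (Q \<omega>) x - e))"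
    by (simp add: expW right_diff_distrib sum_subtractf sum1 flip: sum_distrib_right)
  moreover have "\<dots> \<le> (\<Sum>\<omega>\<in>?S. pmf W \<omega> * (\<Sum>A\<in>\<A>. \<Sum>B\<in>\<A>. \<Gamma> \<omega> A B * g x B))"
    using \<Gamma>(2) by (intro sum_mono mult_left_mono) auto
  ultimately show "measure_pmf.expectation W (\<lambda>\<omega>. z (Q \<omega>) x) \<le> z (bind_pmf W Q) x + e"
    using avg[of "\<lambda>_. g x"] by simp
qed

text \<open>The deterministic core. The multiplier in \<open>F\<close> depends on \<open>p\<close>
  and \<open>x\<close> but not on \<open>p'\<close>, so \<open>est\<close> is a statement about one
  fixed bounded function, to which a concentration inequality applies.\<close>

lemma robust_cost_le_of_truncated_estimate:
  fixes p p' :: "'a pmf"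
  assumes p: "set_pmf p \<subseteq> \<A>" and p': "set_pmf p' \<subseteq> \<A>" and x: "x \<in> P" and x0: "x0 \<in> P"
    and M: "lam * scalar_prod c x0 \<le> M" and e: "0 \<le> e"
  defines "F \<equiv> \<lambda>A. min (penalised_recourse (z p x / (2 * r)) x A) M"
  assumes est: "measure_pmf.expectation p F - e \<le> measure_pmf.expectation p' F"
  shows "h p x \<le> 2 * h p' x + 2 * h p x0 + 2 * e"
proof -
  let ?t = "z p x / (2 * r)"
  note nn = robust_recourse_nonneg[OF p x] robust_recourse_nonneg[OF p' x]
    robust_recourse_nonneg[OF p x0] first_stage_cost_nonneg[OF x] first_stage_cost_nonneg[OF x0]
  have "z p x \<le> 2 * z p' x + 2 * z p x0 + 2 * e"
  proof (cases "z p x \<le> 2 * z p x0")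
    case True
    then show ?thesis using nn e by linarith
  next
    case False
    have t: "0 \<le> ?t" and rt: "r * ?t = z p x / 2" using nn radius by auto
    \<comment> \<open>In this case \<open>z p x0\<close> lies below \<open>r * ?t\<close>, so the
      minimum in the duality bound can only be the expectation.\<close>
    have tail: "measure_pmf.expectation p (penalised_recourse ?t x0) \<le> z p x0"
      using min_dual_le_robust_recourse[OF p x0 t] False unfolding rt by linarith
    have "z p x \<le> z p x / 2 + measure_pmf.expectation p (penalised_recourse ?t x)"
      using robust_recourse_le_dual[OF p x t] unfolding rt .
    also have "measure_pmf.expectation p (penalised_recourse ?t x) \<le>
        measure_pmf.expectation p (\<lambda>A. F A + penalised_recourse ?t x0 A)"
    proof (rule expectation_mono_finite[OF finite_scenarios p])
      fix A assume A: "A \<in> \<A>"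
      \<comment> \<open>Without truncation \<open>F A\<close> alone suffices; with truncation
        \<open>F A = M\<close> covers the inflation term.\<close>
      show "penalised_recourse ?t x A \<le> F A + penalised_recourse ?t x0 A"
        using penalised_recourse_inflation[OF x x0 A, of ?t] penalised_recourse_nonneg[OF x0 A, of ?t] M
        unfolding F_def by linarith
    qed
    also have "\<dots> = measure_pmf.expectation p F + measure_pmf.expectation p (penalised_recourse ?t x0)"
      using finite_subset[OF p finite_scenarios]
      by (intro Bochner_Integration.integral_add integrable_measure_pmf_finite)
    finally have "z p x / 2 \<le> measure_pmf.expectation p' F + e + z p x0"
      using est tail by simp
    also have "measure_pmf.expectation p' F \<le> measure_pmf.expectation p' (penalised_recourse ?t x)"
      by (rule expectation_mono_finite[OF finite_scenarios p']) (simp add: F_def)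
    \<comment> \<open>Applied to \<open>p'\<close>, the duality bound gives either
      \<open>z p x / 2 \<le> z p' x\<close> directly, or that the expectation under
      \<open>p'\<close> is at most \<open>z p' x\<close>.\<close>
    finally show ?thesis
      using min_dual_le_robust_recourse[OF p' x t] nn e unfolding rt by linarith
  qed
  then show ?thesis using nn by (simp add: robust_cost_def)
qed

section \<open>Sampling estimates: Markov, Hoeffding and the union bound\<close>

lemma robust_cost_nonneg: "set_pmf p \<subseteq> \<A> \<Longrightarrow> x \<in> P \<Longrightarrow> 0 \<le> h p x"
  using robust_recourse_nonneg first_stage_cost_nonneg by (simp add: robust_cost_def)

lemma set_empirical_sample:
  assumes "0 < N" "finite I" "{i} \<times> {1..N} \<subseteq> I" "\<omega> \<in> set_pmf (Pi_pmf I d (\<lambda>_. p))"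
    and "set_pmf p \<subseteq> \<A>"
  shows "set_pmf (empirical N (\<lambda>l. \<omega> (i, l))) \<subseteq> \<A>"
proof -
  have "\<omega> (i, l) \<in> set_pmf p" if "l \<in> {1..N}" for l
  proof -
    have "(i, l) \<in> I" using assms(3) that by auto
    then show ?thesis using assms(4) by (auto simp: set_Pi_pmf[OF assms(2)] PiE_dflt_def)
  qed
  then show ?thesis using assms(1,5) by (auto simp: set_empirical)
qed

text \<open>Concavity in the distribution bounds the mean empirical cost by \<open>h p x\<close>;
  Markov's inequality does the rest.\<close>

lemma prob_empirical_cost_large:
  assumes "0 < N" "set_pmf p \<subseteq> \<A>" "x \<in> P" "h p x \<le> b" "0 < b" "0 < \<epsilon>"
  shows "measure_pmf.prob (Pi_pmf ({i} \<times> {1..N}) d (\<lambda>_. p))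
           {\<omega>. (1 + \<epsilon>) * b \<le> h (empirical N (\<lambda>l. \<omega> (i, l))) x} \<le> 1 / (1 + \<epsilon>)"
proof -
  let ?W = "Pi_pmf ({i} \<times> {1..N}) d (\<lambda>_. p)"
  let ?Q = "\<lambda>\<omega>. empirical N (\<lambda>l. \<omega> (i, l))"
  have "finite (set_pmf p)" using assms(2) finite_scenarios finite_subset by blast
  then have fin: "finite (set_pmf ?W)" by (intro finite_set_Pi_pmf) auto
  have supp: "set_pmf (?Q \<omega>) \<subseteq> \<A>" if "\<omega> \<in> set_pmf ?W" for \<omega>
    using assms(1,2) that by (intro set_empirical_sample) auto
  have "measure_pmf.expectation ?W (\<lambda>\<omega>. h (?Q \<omega>) x) =
      scalar_prod c x + measure_pmf.expectation ?W (\<lambda>\<omega>. z (?Q \<omega>) x)"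
    unfolding robust_cost_def using fin
    by (subst Bochner_Integration.integral_add) (auto intro: integrable_measure_pmf_finite)
  also have "measure_pmf.expectation ?W (\<lambda>\<omega>. z (?Q \<omega>) x) \<le> z (bind_pmf ?W ?Q) x"
    using fin supp assms(3) by (rule expectation_robust_recourse_le)
  also have "bind_pmf ?W ?Q = p"
    using assms(1) by (intro bind_empirical) auto
  finally have mean: "measure_pmf.expectation ?W (\<lambda>\<omega>. h (?Q \<omega>) x) \<le> b"
    using assms(4) by (simp add: robust_cost_def)
  have "measure_pmf.prob ?W {\<omega>. (1 + \<epsilon>) * b \<le> h (?Q \<omega>) x} \<le>
      measure_pmf.expectation ?W (\<lambda>\<omega>. h (?Q \<omega>) x) / ((1 + \<epsilon>) * b)"
    using integral_Markov_inequality_measure[of "measure_pmf ?W" "\<lambda>\<omega>. h (?Q \<omega>) x" "{}" "(1 + \<epsilon>) * b"]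
      assms fin supp by (simp add: integrable_measure_pmf_finite AE_measure_pmf_iff robust_cost_nonneg)
  also have "\<dots> \<le> b / ((1 + \<epsilon>) * b)"
    using mean assms by (intro divide_right_mono) auto
  finally show ?thesis using assms by simp
qed

text \<open>Truncation puts \<open>F\<close> into the range from 0 to \<open>M\<close>, so
  Hoeffding's inequality applies to the samples of trial \<open>i\<close>.\<close>

lemma prob_empirical_estimate_small:
  fixes t :: real
  assumes "0 < N" "finite I" "{i} \<times> {1..N} \<subseteq> I" "set_pmf p \<subseteq> \<A>" "x \<in> P" "0 < M" "0 \<le> e"
  defines "F \<equiv> \<lambda>A. min (penalised_recourse t x A) M"
  shows "measure_pmf.prob (Pi_pmf I d (\<lambda>_. p))
           {\<omega>. measure_pmf.expectation (empirical N (\<lambda>l. \<omega> (i, l))) F \<le> measure_pmf.expectation p F - e}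
         \<le> exp (- 2 * real N * e\<^sup>2 / M\<^sup>2)"
proof -
  have F: "0 \<le> F A \<and> F A \<le> M" if "A \<in> set_pmf p" for A
    unfolding F_def using penalised_recourse_nonneg that assms by auto
  have "(\<Sum>y\<in>{i} \<times> {1..N}. F (\<omega> y)) = (\<Sum>l=1..N. F (\<omega> (i, l)))" for \<omega>
    by (rule sum.reindex_bij_witness[of _ "Pair i" snd]) auto
  then show ?thesis
    using hoeffding_lower_tail_Pi_pmf[of I "{i} \<times> {1..N}" M e p F d] F assms(1-7)
    by (simp add: expectation_empirical)
qed

text \<open>The trials are independent and each fails with probability at most
  \<open>1 / (1 + \<epsilon>)\<close>. Since
  \<open>exp (\<epsilon> / 2) \<le> 1 + \<epsilon>\<close>, the factor \<open>2 / \<epsilon>\<close>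
  in the number of trials brings the product down to \<open>\<delta>\<close>.\<close>

lemma prob_no_good_trial:
  assumes "0 < N" "set_pmf p \<subseteq> \<A>" "x \<in> P" "h p x \<le> b" "0 < b"
    and \<epsilon>: "0 < \<epsilon>" "\<epsilon> \<le> 1/3" and \<delta>: "0 < \<delta>" and k: "2 / \<epsilon> * ln (1 / \<delta>) \<le> real k"
  shows "measure_pmf.prob (Pi_pmf ({1..k} \<times> {1..N}) d (\<lambda>_. p))
           {\<omega>. \<forall>i\<in>{1..k}. (1 + \<epsilon>) * b \<le> h (empirical N (\<lambda>l. \<omega> (i, l))) x} \<le> \<delta>"
proof -
  have "measure_pmf.prob (Pi_pmf ({1..k} \<times> {1..N}) d (\<lambda>_. p))
      {\<omega>. \<forall>i\<in>{1..k}. (1 + \<epsilon>) * b \<le> h (empirical N (\<lambda>l. \<omega> (i, l))) x} \<le> (1 / (1 + \<epsilon>)) ^ card {1..k}"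
  proof (rule prob_Pi_pmf_all_blocks_le)
    show "finite (set_pmf p)" using assms(2) finite_scenarios finite_subset by blast
    fix i and \<omega> \<omega>' :: "nat \<times> nat \<Rightarrow> 'a" assume "\<And>l. l \<in> {1..N} \<Longrightarrow> \<omega> (i, l) = \<omega>' (i, l)"
    then have "empirical N (\<lambda>l. \<omega> (i, l)) = empirical N (\<lambda>l. \<omega>' (i, l))"
      using assms(1) by (intro empirical_cong) auto
    then show "((1 + \<epsilon>) * b \<le> h (empirical N (\<lambda>l. \<omega> (i, l))) x) =
        ((1 + \<epsilon>) * b \<le> h (empirical N (\<lambda>l. \<omega>' (i, l))) x)" by simp
  qed (use assms prob_empirical_cost_large in auto)
  also have "(1 / (1 + \<epsilon>)) ^ card {1..k} \<le> \<delta>"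
  proof -
    have "exp (\<epsilon> / 2) \<le> 1 + \<epsilon> / 2 + (\<epsilon> / 2)\<^sup>2" using \<epsilon> by (intro exp_bound) auto
    also have "\<dots> \<le> 1 + \<epsilon>"
      using \<epsilon> mult_right_mono[of \<epsilon> 1 \<epsilon>] by (simp add: power2_eq_square field_simps)
    finally have "exp (\<epsilon> / 2) ^ k \<le> (1 + \<epsilon>) ^ k" by (intro power_mono) auto
    moreover have "ln (1 / \<delta>) \<le> real k * (\<epsilon> / 2)" using k \<epsilon> by (simp add: field_simps)
    then have "1 / \<delta> \<le> exp (real k * (\<epsilon> / 2))" 
      using \<delta> by (metis exp_le_cancel_iff exp_ln zero_less_divide_1_iff)
    then have "1 / \<delta> \<le> exp (\<epsilon> / 2) ^ k" by (simp only: exp_of_nat_mult)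
    ultimately have "1 / \<delta> \<le> (1 + \<epsilon>) ^ k" by linarith
    then show ?thesis using \<epsilon> \<delta> by (simp add: power_divide field_simps)
  qed
  finally show ?thesis .
qed

text \<open>Two bad events of probability at most \<open>\<delta>\<close> each are excluded:
  \<open>x0\<close> is expensive in every trial, or some estimate is too low. The second ranges over
  all trials and all of \<open>X\<close>, so \<open>xhat\<close>, \<open>f\<close> and
  \<open>j\<close> may depend on the samples.\<close>

lemma prob_best_of_k_good:
  fixes p :: "'a pmf"
  assumes \<epsilon>: "0 < \<epsilon>" "\<epsilon> \<le> 1/3" and \<kappa>: "0 < \<kappa>" and \<delta>: "0 < \<delta>"
    and k: "2 / \<epsilon> * ln (1 / \<delta>) \<le> real k"
    and N: "0 < N" "real k * real (card X) * exp (- 2 * real N * (\<epsilon> / lam)\<^sup>2) \<le> \<delta>"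
    and p: "set_pmf p \<subseteq> \<A>" and \<beta>: "1 \<le> \<beta>" and \<rho>: "1 \<le> \<rho>"
  shows "measure_pmf.prob (Pi_pmf ({1..k} \<times> {1..N}) undefined (\<lambda>_. p))
           {\<omega>. \<forall>(xhat :: nat \<Rightarrow> real Matrix.vec) (f :: nat \<Rightarrow> real) j.
              (\<forall>i\<in>{1..k}.
                 xhat i \<in> X \<and>
                 h (empirical N (\<lambda>l. \<omega> (i, l))) (xhat i) \<le> \<beta> * f i \<and>
                 f i \<le> \<rho> * Min (h (empirical N (\<lambda>l. \<omega> (i, l))) ` X)) \<and>
              is_arg_min f (\<lambda>i. i \<in> {1..k}) j \<longrightarrow>
              h p (xhat j) \<le> 4 * \<beta> * \<rho> * (1 + 1 * \<epsilon>) * Min (h p ` X) + 2 * \<beta> * \<rho> * \<kappa>}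
         \<ge> 1 - 2 * \<delta>"
    (is "measure_pmf.prob ?W ?good \<ge> _")
proof -
  have "Min (h p ` X) \<in> h p ` X"
    using finite_X zero_feasible by (intro Min_in) auto
  then obtain x0 where x0: "x0 \<in> X" "h p x0 = Min (h p ` X)" by auto
  have x0P: "x0 \<in> P" using x0 X_subset by blast
  \<comment> \<open>The final factor \<open>4 * \<beta> * \<rho> * (1 + \<epsilon>)\<close> turns
    the summand \<open>\<kappa> / 4\<close> into at most
    \<open>2 * \<beta> * \<rho> * \<kappa>\<close>.\<close>
  define b where "b = h p x0 + \<kappa> / 4"
  have hx0: "0 \<le> h p x0" using p x0P by (rule robust_cost_nonneg)
  have b: "0 < b" "h p x0 \<le> b" using hx0 \<kappa> by (auto simp: b_def)
  define M where "M = lam * b"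
  define F where "F x = (\<lambda>A. min (penalised_recourse (z p x / (2 * r)) x A) M)" for x
  have M: "0 < M" using b inflation_ge_1 by (simp add: M_def)
  have cM: "lam * scalar_prod c x0 \<le> M"
    unfolding M_def using inflation_ge_1 b robust_recourse_nonneg[OF p x0P]
    by (intro mult_left_mono) (auto simp: robust_cost_def)
  let ?Q = "\<lambda>\<omega> i. empirical N (\<lambda>l. \<omega> (i, l))"
  define E1 where "E1 = {\<omega>. \<forall>i\<in>{1..k}. (1 + \<epsilon>) * b \<le> h (?Q \<omega> i) x0}"
  define E where "E y = {\<omega>. measure_pmf.expectation (?Q \<omega> (fst y)) (F (snd y)) \<le>
      measure_pmf.expectation p (F (snd y)) - \<epsilon> * b}" for y :: "nat \<times> real Matrix.vec"
  have "measure_pmf.prob ?W E1 \<le> \<delta>"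
    unfolding E1_def using prob_no_good_trial N p x0P b \<epsilon> \<delta> k by blast
  moreover have "measure_pmf.prob ?W (\<Union>y\<in>{1..k} \<times> X. E y) \<le> \<delta>"
  proof -
    have "measure_pmf.prob ?W (\<Union>y\<in>{1..k} \<times> X. E y) \<le> (\<Sum>y\<in>{1..k} \<times> X. measure_pmf.prob ?W (E y))"
      using finite_X by (intro measure_pmf.finite_measure_subadditive_finite) auto
    also have "\<dots> \<le> (\<Sum>y\<in>{1..k} \<times> X. exp (- 2 * real N * (\<epsilon> * b)\<^sup>2 / M\<^sup>2))"
    proof (rule sum_mono)
      fix y assume "y \<in> {1..k} \<times> X"
      then show "measure_pmf.prob ?W (E y) \<le> exp (- 2 * real N * (\<epsilon> * b)\<^sup>2 / M\<^sup>2)"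
        unfolding E_def F_def using N p M \<epsilon> b X_subset
        by (intro prob_empirical_estimate_small) auto
    qed
    \<comment> \<open>With error \<open>\<epsilon> * b\<close> and level \<open>M = lam * b\<close>,
      the unknown \<open>b\<close> cancels, so the sample size need not depend on it.\<close>
    also have "\<dots> = real k * real (card X) * exp (- 2 * real N * (\<epsilon> / lam)\<^sup>2)"
      using b by (simp add: M_def card_cartesian_product power_mult_distrib power_divide)
    finally show ?thesis using N by simp
  qed
  ultimately have "measure_pmf.prob ?W (E1 \<union> (\<Union>y\<in>{1..k} \<times> X. E y)) \<le> 2 * \<delta>"
    using measure_Un_le[of E1 "measure_pmf ?W" "\<Union>y\<in>{1..k} \<times> X. E y"] by simp
  then have "1 - 2 * \<delta> \<le> measure_pmf.prob ?W (- (E1 \<union> (\<Union>y\<in>{1..k} \<times> X. E y)))"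
    using measure_pmf.prob_compl[of "E1 \<union> (\<Union>y\<in>{1..k} \<times> X. E y)" ?W]
    by (simp add: Compl_eq_Diff_UNIV)
  \<comment> \<open>On the support of the sample space all empirical distributions live on
    \<open>\<A>\<close>.\<close>
  also have "\<dots> = measure_pmf.prob ?W (- (E1 \<union> (\<Union>y\<in>{1..k} \<times> X. E y)) \<inter> set_pmf ?W)"
    by (simp add: measure_Int_set_pmf)
  also have "\<dots> \<le> measure_pmf.prob ?W ?good"
  proof (intro measure_pmf.finite_measure_mono subsetI)
    fix \<omega> assume \<omega>: "\<omega> \<in> - (E1 \<union> (\<Union>y\<in>{1..k} \<times> X. E y)) \<inter> set_pmf ?W"
    then obtain i where i: "i \<in> {1..k}" "h (?Q \<omega> i) x0 < (1 + \<epsilon>) * b"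
      by (auto simp: E1_def not_le)
    have est: "measure_pmf.expectation p (F x) - \<epsilon> * b \<le> measure_pmf.expectation (?Q \<omega> j) (F x)"
      if "j \<in> {1..k}" "x \<in> X" for j x
    proof -
      have "\<omega> \<notin> E (j, x)" using \<omega> that by auto
      then show ?thesis by (simp add: E_def)
    qed
    show "\<omega> \<in> ?good"
    proof (intro CollectI allI impI)
      fix xhat :: "nat \<Rightarrow> real Matrix.vec" and f :: "nat \<Rightarrow> real" and j
      assume A: "(\<forall>i\<in>{1..k}. xhat i \<in> X \<and> h (?Q \<omega> i) (xhat i) \<le> \<beta> * f i \<and>
          f i \<le> \<rho> * Min (h (?Q \<omega> i) ` X)) \<and> is_arg_min f (\<lambda>i. i \<in> {1..k}) j"
      then have j: "j \<in> {1..k}" and fj: "f j \<le> f i"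
        using i(1) by (auto simp: is_arg_min_linorder)
      have xj: "xhat j \<in> X" using A j by blast
      then have xjP: "xhat j \<in> P" using X_subset by blast
      \<comment> \<open>The chosen trial \<open>j\<close> need not be the good trial
        \<open>i\<close>: minimality of \<open>f j\<close> transfers the bound from \<open>i\<close>
        to \<open>j\<close>.\<close>
      have "f j \<le> \<rho> * Min (h (?Q \<omega> i) ` X)" using A i(1) fj by force
      also have "\<dots> \<le> \<rho> * ((1 + \<epsilon>) * b)"
      proof (intro mult_left_mono)
        have "Min (h (?Q \<omega> i) ` X) \<le> h (?Q \<omega> i) x0" using finite_X x0 by (intro Min_le) auto
        then show "Min (h (?Q \<omega> i) ` X) \<le> (1 + \<epsilon>) * b" using i(2) by linarith
      qed (use \<rho> in auto)
      finally have "\<beta> * f j \<le> \<beta> * (\<rho> * ((1 + \<epsilon>) * b))" using \<beta> by (intro mult_left_mono) auto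
      moreover have "h (?Q \<omega> j) (xhat j) \<le> \<beta> * f j" using A j by blast
      ultimately have emp: "h (?Q \<omega> j) (xhat j) \<le> \<beta> * \<rho> * ((1 + \<epsilon>) * b)" by (simp add: mult.assoc)
      have supp: "set_pmf (?Q \<omega> j) \<subseteq> \<A>"
        using N p \<omega> j by (intro set_empirical_sample[where I = "{1..k} \<times> {1..N}"]) auto
      have "h p (xhat j) \<le> 2 * h (?Q \<omega> j) (xhat j) + 2 * h p x0 + 2 * (\<epsilon> * b)"
        using est[OF j xj] p supp xjP x0P cM \<epsilon> b unfolding F_def
        by (intro robust_cost_le_of_truncated_estimate) auto
      also have "\<dots> \<le> 2 * (\<beta> * \<rho> * ((1 + \<epsilon>) * b)) + 2 * ((1 + \<epsilon>) * b)"
        using emp b by (simp add: algebra_simps)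
      also have "\<dots> \<le> 2 * (\<beta> * \<rho> * ((1 + \<epsilon>) * b)) + 2 * (\<beta> * \<rho> * ((1 + \<epsilon>) * b))"
      proof -
        have "1 * 1 \<le> \<beta> * \<rho>" using \<beta> \<rho> by (intro mult_mono) auto
        then have "1 * ((1 + \<epsilon>) * b) \<le> \<beta> * \<rho> * ((1 + \<epsilon>) * b)"
          using \<epsilon> b by (intro mult_right_mono) auto
        then show ?thesis by linarith
      qed
      also have "\<dots> = 4 * \<beta> * \<rho> * (1 + \<epsilon>) * h p x0 + \<beta> * \<rho> * \<kappa> * (1 + \<epsilon>)"
        by (simp add: b_def algebra_simps)
      also have "\<beta> * \<rho> * \<kappa> * (1 + \<epsilon>) \<le> \<beta> * \<rho> * \<kappa> * 2"
        using \<epsilon> \<beta> \<rho> \<kappa> by (intro mult_left_mono) auto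
      finally show "h p (xhat j) \<le> 4 * \<beta> * \<rho> * (1 + 1 * \<epsilon>) * Min (h p ` X) + 2 * \<beta> * \<rho> * \<kappa>"
        by (simp add: x0(2) mult_ac)
    qed
  qed auto
  finally show ?thesis .
qed

text \<open>After taking logarithms, the claim is that \<open>2 * N / u\<^sup>2\<close> dominates
  \<open>ln k + v + w\<close>.\<close>

lemma sample_size_sufficient:
  assumes \<epsilon>: "0 < \<epsilon>" "\<epsilon> \<le> 1/3" and \<delta>: "0 < \<delta>" "\<delta> < 1"
    and k: "k = nat \<lceil>2 / \<epsilon> * ln (1 / \<delta>)\<rceil>"
    and N: "(lam / \<epsilon>)\<^sup>2 * (1 + 2 * (lam / \<epsilon>) * ln (1 / \<delta>) + ln (real (card X)) + ln (1 / \<delta>)) \<le> real N"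
  shows "real k * real (card X) * exp (- 2 * real N * (\<epsilon> / lam)\<^sup>2) \<le> \<delta>"
proof -
  define u v w where "u = lam / \<epsilon>" and "v = ln (real (card X))" and "w = ln (1 / \<delta>)"
  have w: "0 < w" using \<delta> by (simp add: w_def)
  have u: "0 < u" "1 / \<epsilon> \<le> u" using \<epsilon> inflation_ge_1 by (auto simp: u_def divide_right_mono)
  have cardX: "0 < card X" using finite_X zero_feasible by (auto simp: card_gt_0_iff)
  then have v: "0 \<le> v" by (simp add: v_def)
  have pos: "0 < 2 / \<epsilon> * w" using w \<epsilon> by simp
  then have k0: "0 < real k" unfolding k w_def by simp
  have "real k \<le> 2 / \<epsilon> * w + 1" using pos unfolding k w_def[symmetric] by linarith
  also have "2 / \<epsilon> * w \<le> 2 * u * w" using u w by (intro mult_right_mono) auto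
  \<comment> \<open>The 1 lost by rounding \<open>k\<close> up is regained from
    \<open>ln k \<le> k - 1\<close>.\<close>
  finally have lnk: "ln (real k) \<le> 2 * u * w" using ln_le_minus_one[OF k0] by linarith
  have "1 + 2 * u * w + v + w \<le> real N / u\<^sup>2"
    using N u(1) unfolding u_def[symmetric] v_def[symmetric] w_def[symmetric]
    by (simp add: field_simps)
  \<comment> \<open>One copy of \<open>N / u\<^sup>2\<close> already suffices; the second one in the
    exponent is dropped by its sign.\<close>
  moreover have "0 \<le> real N / u\<^sup>2" by simp
  ultimately have "ln (real k) + v + - 2 * (real N / u\<^sup>2) \<le> - w" using lnk v w by linarith
  then have "exp (ln (real k) + v + - 2 * (real N / u\<^sup>2)) \<le> exp (- w)" by simp
  moreover have "exp (- w) = \<delta>" using \<delta> by (simp add: w_def ln_div)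
  moreover have "- 2 * real N * (\<epsilon> / lam)\<^sup>2 = - 2 * (real N / u\<^sup>2)"
    using \<epsilon> by (simp add: u_def power_divide)
  moreover have "exp (ln (real k) + v + - 2 * (real N / u\<^sup>2)) =
      real k * real (card X) * exp (- 2 * (real N / u\<^sup>2))"
    unfolding v_def exp_add using k0 cardX by simp
  ultimately show ?thesis by simp
qed

end

section \<open>The polynomial sample size and the final statement\<close>

text \<open>The constant coefficient pays for rounding the sample size up to an integer.\<close>

definition sample_coeff :: "nat \<Rightarrow> nat \<Rightarrow> nat \<Rightarrow> nat \<Rightarrow> real" where
  "sample_coeff i j k l =
     (if (i, j, k, l) = (3, 0, 0, 1) then 2
      else if (i, j, k, l) \<in> {(0, 0, 0, 0), (2, 0, 0, 0), (2, 1, 0, 0), (2, 0, 0, 1)} then 1 else 0)"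

lemma quad_poly_sample_coeff:
  "quad_poly 3 sample_coeff u v w z = u\<^sup>2 * (1 + 2 * u * z + v + z) + 1"
proof -
  have "{..3::nat} = {0, 1, 2, 3}" by auto
  then show ?thesis
    by (simp add: quad_poly_def sample_coeff_def algebra_simps power2_eq_square power3_eq_cube)
qed

theorem theorem3p5:
  shows "\<exists>(d::nat) (a :: nat \<Rightarrow> nat \<Rightarrow> nat \<Rightarrow> nat \<Rightarrow> real) (C::real). 0 \<le> C \<and>
    (\<forall>(\<epsilon>::real) (\<kappa>::real) (\<delta>::real)
       m P c (\<A> :: 'a set) g \<kappa>sc r lam R V K \<tau> sz q.
       0 < \<epsilon> \<and> \<epsilon> \<le> 1/3 \<and> 0 < \<kappa> \<and> 0 < \<delta> \<and> \<delta> < 1 \<and>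
       dr_two_stage m P c \<A> g \<kappa>sc r lam R V K \<tau> sz q \<longrightarrow>
       (let X = int_points P;
            h = robust_cost c \<A> g \<kappa>sc r;
            k = nat \<lceil>2 / \<epsilon> * ln (1 / \<delta>)\<rceil>
        in \<exists>N::nat. 0 < N \<and>
             real N \<le> quad_poly d a (lam / \<epsilon>) (ln (real (card X))) (ln (\<tau> / \<kappa>)) (ln (1 / \<delta>)) \<and>
             (\<forall>(p :: 'a pmf) (\<beta>::real) (\<rho>::real).
                set_pmf p \<subseteq> \<A> \<and> 1 \<le> \<beta> \<and> 1 \<le> \<rho> \<longrightarrow>
                measure_pmf.prob (Pi_pmf ({1..k} \<times> {1..N}) undefined (\<lambda>_. p))
                  {\<omega>. \<forall>(xhat :: nat \<Rightarrow> real Matrix.vec) (f :: nat \<Rightarrow> real) j.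
                     (\<forall>i\<in>{1..k}.
                        xhat i \<in> X \<and>
                        h (empirical N (\<lambda>l. \<omega> (i, l))) (xhat i) \<le> \<beta> * f i \<and>
                        f i \<le> \<rho> * Min (h (empirical N (\<lambda>l. \<omega> (i, l))) ` X)) \<and>
                     is_arg_min f (\<lambda>i. i \<in> {1..k}) j \<longrightarrow>
                     h p (xhat j) \<le> 4 * \<beta> * \<rho> * (1 + C * \<epsilon>) * Min (h p ` X) + 2 * \<beta> * \<rho> * \<kappa>}
                \<ge> 1 - 3 * \<delta>)))"
proof (intro exI conjI allI impI)
  \<comment> \<open>This fixes \<open>C\<close> as 1; like the degree 3 and
    \<open>sample_coeff\<close> below, it is the same for all instances.\<close>
  show "0 \<le> (1::real)" by simp
next
  fix \<epsilon> \<kappa> \<delta> :: real and m P c and \<A> :: "'a set" and g \<kappa>sc r lam R V K \<tau> sz q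
  assume asm: "0 < \<epsilon> \<and> \<epsilon> \<le> 1/3 \<and> 0 < \<kappa> \<and> 0 < \<delta> \<and> \<delta> < 1 \<and>
    dr_two_stage m P c \<A> g \<kappa>sc r lam R V K \<tau> sz q"
  then interpret dr_two_stage m P c \<A> g \<kappa>sc r lam R V K \<tau> sz q by blast
  define k where "k = nat \<lceil>2 / \<epsilon> * ln (1 / \<delta>)\<rceil>"
  define T where "T = (lam / \<epsilon>)\<^sup>2 *
    (1 + 2 * (lam / \<epsilon>) * ln (1 / \<delta>) + ln (real (card (int_points P))) + ln (1 / \<delta>))"
  define N where "N = nat \<lceil>T\<rceil>"
  have "0 < card (int_points P)" using finite_X zero_feasible by (auto simp: card_gt_0_iff)
  then have T: "0 < T" unfolding T_def using asm inflation_ge_1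
    by (intro mult_pos_pos add_pos_nonneg) auto
  have N: "0 < N" "T \<le> real N" "real N \<le> T + 1" using T unfolding N_def by linarith+
  have k: "2 / \<epsilon> * ln (1 / \<delta>) \<le> real k" unfolding k_def by linarith
  have size: "real k * real (card (int_points P)) * exp (- 2 * real N * (\<epsilon> / lam)\<^sup>2) \<le> \<delta>"
    using asm N(2) by (intro sample_size_sufficient k_def) (auto simp: T_def)
  show "let X = int_points P;
            h = robust_cost c \<A> g \<kappa>sc r;
            k = nat \<lceil>2 / \<epsilon> * ln (1 / \<delta>)\<rceil>
        in \<exists>N::nat. 0 < N \<and>
             real N \<le> quad_poly 3 sample_coeff (lam / \<epsilon>) (ln (real (card X))) (ln (\<tau> / \<kappa>)) (ln (1 / \<delta>)) \<and>
             (\<forall>(p :: 'a pmf) (\<beta>::real) (\<rho>::real).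
                set_pmf p \<subseteq> \<A> \<and> 1 \<le> \<beta> \<and> 1 \<le> \<rho> \<longrightarrow>
                measure_pmf.prob (Pi_pmf ({1..k} \<times> {1..N}) undefined (\<lambda>_. p))
                  {\<omega>. \<forall>(xhat :: nat \<Rightarrow> real Matrix.vec) (f :: nat \<Rightarrow> real) j.
                     (\<forall>i\<in>{1..k}.
                        xhat i \<in> X \<and>
                        h (empirical N (\<lambda>l. \<omega> (i, l))) (xhat i) \<le> \<beta> * f i \<and>
                        f i \<le> \<rho> * Min (h (empirical N (\<lambda>l. \<omega> (i, l))) ` X)) \<and>
                     is_arg_min f (\<lambda>i. i \<in> {1..k}) j \<longrightarrow>
                     h p (xhat j) \<le> 4 * \<beta> * \<rho> * (1 + 1 * \<epsilon>) * Min (h p ` X) + 2 * \<beta> * \<rho> * \<kappa>}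
                \<ge> 1 - 3 * \<delta>)"
    unfolding Let_def k_def[symmetric]
  proof (intro exI[of _ N] conjI allI impI)
    show "real N \<le> quad_poly 3 sample_coeff (lam / \<epsilon>) (ln (real (card (int_points P))))
        (ln (\<tau> / \<kappa>)) (ln (1 / \<delta>))"
      unfolding quad_poly_sample_coeff using N(3) by (simp add: T_def)
  next
    fix p :: "'a pmf" and \<beta> \<rho> :: real
    assume "set_pmf p \<subseteq> \<A> \<and> 1 \<le> \<beta> \<and> 1 \<le> \<rho>"
    then show "1 - 3 * \<delta> \<le> measure_pmf.prob (Pi_pmf ({1..k} \<times> {1..N}) undefined (\<lambda>_. p))
        {\<omega>. \<forall>(xhat :: nat \<Rightarrow> real Matrix.vec) (f :: nat \<Rightarrow> real) j.
           (\<forall>i\<in>{1..k}.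
              xhat i \<in> int_points P \<and>
              robust_cost c \<A> g \<kappa>sc r (empirical N (\<lambda>l. \<omega> (i, l))) (xhat i) \<le> \<beta> * f i \<and>
              f i \<le> \<rho> * Min (robust_cost c \<A> g \<kappa>sc r (empirical N (\<lambda>l. \<omega> (i, l))) ` int_points P)) \<and>
           is_arg_min f (\<lambda>i. i \<in> {1..k}) j \<longrightarrow>
           robust_cost c \<A> g \<kappa>sc r p (xhat j) \<le>
             4 * \<beta> * \<rho> * (1 + 1 * \<epsilon>) * Min (robust_cost c \<A> g \<kappa>sc r p ` int_points P) + 2 * \<beta> * \<rho> * \<kappa>}"
      \<comment> \<open>The two bad events cost only \<open>2 * \<delta>\<close>, which is within
        the allowed \<open>3 * \<delta>\<close>.\<close>
      using asm k N(1) size by (intro order_trans[OF _ prob_best_of_k_good]) auto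
  qed (use N in auto)
qed

end
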